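(* For every integer $n\ge 2$, the set of roots $\widetilde{\mathcal{R}}(n)$ satisfies the following properties: (a) It is a convex cone (that is, it is convex and closed under multiplication by positive real scalars) containing the negative real axis $\mathbb{R}_{<0}$. (b) It is half-open, i.e., it does not contain the ray of its boundary not consisting of $\mathbb{R}_{<0}$: writing the boundary of $\widetilde{\mathcal{R}}(n)$ in $\mathbb{C}$ as the union of the two rays from the origin bounding the cone, one of which is the non-positive real axis, no point of the other ray belongs to $\widetilde{\mathcal{R}}(n)$. (c) It is monotonous in the dimension, i.e., $\widetilde{\mathcal{R}}(n)\subseteq\widetilde{\mathcal{R}}(n+1)$.
   Context: A star body in $\mathbb{R}^n$ is a compact set $K\subset\mathbb{R}^n$ which is nonempty and starshaped with respect to the origin (i.e. $[0,x]\subseteq K$ for all $x\in K$) and whose radial function $\rho_K(u)=\max\{\lambda\ge 0:\lambda u\in K\}$, $u\in\mathbb{S}^{n-1}$, is positive and continuous on $\mathbb{S}^{n-1}$. $\mathcal{S}^n_0$ denotes the set of all star bodies in $\mathbb{R}^n$. For $K,L\in\mathcal{S}^n_0$ and $i\in\mathbb{R}$, the $i$-th dual quermassintegral is $\widetilde{\mathrm{W}}_i(K,L)=\frac1n\int_{\mathbb{S}^{n-1}}\rho_K(u)^{n-i}\rho_L(u)^i\,d\sigma(u)$, where $\sigma$ is the usual spherical Lebesgue measure. The dual Steiner polynomial of $K,L\in\mathcal{S}^n_0$ is $\widetilde{f}_{K,L}(z)=\sum_{i=0}^n\binom{n}{i}\widetilde{\mathrm{W}}_i(K,L)z^i$, $z\in\mathbb{C}$.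 Let $\mathbb{C}^+=\{z\in\mathbb{C}:\operatorname{Im}(z)\ge0\}$. For $n\ge2$, $\widetilde{\mathcal{R}}(n)=\{z\in\mathbb{C}^+:\widetilde{f}_{K,L}(z)=0\text{ for some }K,L\in\mathcal{S}^n_0\}$. *)

theory Defs
  imports "HOL-Analysis.Analysis"
begin

(* The Euclidean space of dimension n is rendered as real ^ 'n with n = CARD('n). *)

definition radial :: "(real ^ 'n) set \<Rightarrow> real ^ 'n \<Rightarrow> real" where
  "radial K u = (GREATEST l. 0 \<le> l \<and> l *\<^sub>R u \<in> K)"

definition star_body :: "(real ^ 'n) set \<Rightarrow> bool" where
  "star_body K \<longleftrightarrow>
     compact K \<and> K \<noteq> {} \<and> (\<forall>x\<in>K. closed_segment 0 x \<subseteq> K) \<and>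
     (\<forall>u\<in>sphere 0 1. radial K u > 0) \<and> continuous_on (sphere 0 1) (radial K)"

(* Spherical Lebesgue measure, normalised as surface area: the measure of a Borel subset A
   of the unit sphere is n times the volume of the cone {t u | 0 < t <= 1, u in A}.
   It is carried by the Borel sets of the ambient space and concentrated on the sphere. *)
definition spherical_measure :: "(real ^ 'n) measure" where
  "spherical_measure =
     scale_measure (of_nat CARD('n)) (distr (restrict_space lborel (cball 0 1 - {0})) borel sgn)"

definition dual_quermassintegral :: "real \<Rightarrow> (real ^ 'n) set \<Rightarrow> (real ^ 'n) set \<Rightarrow> real" where
  "dual_quermassintegral i K L =
     1 / real CARD('n) *
       (LINT u:sphere 0 1|spherical_measure.
          radial K u powr (real CARD('n) - i) * radial L u powr i)"

definition dual_steiner_poly :: "(real ^ 'n) set \<Rightarrow> (real ^ 'n) set \<Rightarrow> complex \<Rightarrow> complex" where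
  "dual_steiner_poly K L z =
     (\<Sum>i=0..CARD('n).
        of_nat (CARD('n) choose i) * complex_of_real (dual_quermassintegral (real i) K L) * z ^ i)"

(* The type argument carries the dimension: this is the root set for n = CARD('n). *)
definition dual_steiner_roots :: "'n::finite itself \<Rightarrow> complex set" where
  "dual_steiner_roots n =
     {z. Im z \<ge> 0 \<and>
         (\<exists>(K :: (real ^ 'n) set) L. star_body K \<and> star_body L \<and> dual_steiner_poly K L z = 0)}"

definition ray :: "complex \<Rightarrow> complex set" where
  "ray w = {t *\<^sub>R w | t. t \<ge> 0}"

end

theory Submission
  imports Defs
begin

text \<open>
Write \<open>n\<close> for the dimension.  By the binomial theorem the dual Steiner polynomial of \<open>K\<close> and
\<open>L\<close> at \<open>z\<close> is \<open>1 / n\<close> times the integral over the sphere of the \<open>n\<close>-th power of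
\<open>radial K u + z * radial L u\<close> (\<open>dual_steiner_poly_eq_integral\<close>).  All the claims follow from
the explicit description of the root set that this yields (\<open>dual_steiner_roots_eq\<close>): it consists of
the \<open>z\<close> with \<open>pi / n < Arg z\<close>.

If \<open>z\<close> lies in the closed upper half-plane and \<open>Arg z \<le> pi / n\<close>, the integrand stays in a
fixed open half-plane bounded by a line through the origin, so the integral is not zero
(\<open>dual_steiner_poly_nonzero\<close>).

Conversely let \<open>pi / n < Arg z\<close>.  A negative real is a root for two balls.  Otherwise write the
integrand as a weight \<open>w = radial L u ^ n\<close> times the \<open>n\<close>-th power of \<open>\<xi> + z\<close>, where
\<open>\<xi>\<close> is the ratio of the two radial functions.  Both \<open>\<xi>\<close> and \<open>w\<close> can be arbitrary positive
continuous functions on the sphere.  Since the powers turn through an angle larger than \<open>pi\<close>, one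
can choose \<open>\<xi>\<close> such that their values are not contained in a closed half-plane through the origin
(\<open>shifted_powers_not_in_halfspace\<close>, \<open>exists_continuous_on_sphere_covering\<close>).  A separation
argument then provides a weight for which the integral vanishes
(\<open>exists_weight_set_integral_zero\<close>).

The set of all \<open>z\<close> with \<open>c < Arg z\<close> is, for \<open>0 < c < pi\<close>, the intersection of a closed and
an open half-plane, which gives convexity and the two boundary rays, and it grows as
\<open>c = pi / n\<close> decreases.
\<close>

section \<open>Spherical measure\<close>

lemma sets_spherical_measure [simp, measurable_cong]:
  "sets (spherical_measure :: (real ^ 'n::finite) measure) = sets borel"
  by (simp add: spherical_measure_def)

lemma space_spherical_measure [simp]:
  "space (spherical_measure :: (real ^ 'n::finite) measure) = UNIV"
  by (simp add: spherical_measure_def space_scale_measure)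

lemma sgn_measurable_punctured_ball:
  "sgn \<in> borel_measurable (restrict_space lborel (cball 0 1 - {0 :: real ^ 'n::finite}))"
  by (intro measurable_restrict_space1) simp

lemma emeasure_spherical_measure:
  fixes B :: "(real ^ 'n::finite) set"
  assumes "B \<in> sets borel"
  shows "emeasure spherical_measure B =
    of_nat CARD('n) * emeasure lborel (sgn -` B \<inter> (cball 0 1 - {0}))"
proof -
  have "emeasure (distr (restrict_space lborel (cball 0 1 - {0})) borel sgn) B =
      emeasure (restrict_space lborel (cball 0 1 - {0})) (sgn -` B \<inter> (cball 0 1 - {0}))"
    using assms by (subst emeasure_distr[OF sgn_measurable_punctured_ball])
      (auto simp: space_restrict_space)
  also have "\<dots> = emeasure lborel (sgn -` B \<inter> (cball 0 1 - {0}))"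
    by (rule emeasure_restrict_space) auto
  finally show ?thesis by (simp add: spherical_measure_def)
qed

lemma finite_measure_spherical_measure:
  "finite_measure (spherical_measure :: (real ^ 'n::finite) measure)"
proof
  have "emeasure lborel (cball 0 1 - {0 :: real ^ 'n}) < \<infinity>"
    by (rule emeasure_bounded_finite) (simp add: bounded_diff)
  then show "emeasure (spherical_measure :: (real ^ 'n) measure) (space spherical_measure) \<noteq> \<infinity>"
    by (simp add: emeasure_spherical_measure ennreal_mult_eq_top_iff)
qed

lemma set_integrable_spherical_measure:
  fixes f :: "real ^ 'n::finite \<Rightarrow> 'b::{banach, second_countable_topology}"
  assumes "continuous_on (sphere 0 1) f"
  shows "set_integrable spherical_measure (sphere 0 1) f"
proof -
  interpret finite_measure "spherical_measure :: (real ^ 'n) measure"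
    by (rule finite_measure_spherical_measure)
  have "compact (f ` sphere 0 1)"
    using assms by (intro compact_continuous_image) auto
  then obtain C where C: "C > 0" "\<And>x. x \<in> sphere 0 1 \<Longrightarrow> norm (f x) \<le> C"
    by (metis bounded_pos compact_imp_bounded imageI)
  have "(\<lambda>x. indicator (sphere 0 1) x *\<^sub>R f x) \<in> borel_measurable borel"
    by (rule borel_measurable_continuous_on_indicator[OF _ assms]) auto
  then show ?thesis
    unfolding set_integrable_def using C
    by (intro integrable_const_bound[where B = C]) (auto simp: indicator_def)
qed

text \<open>
Spherical measure charges every nonempty relatively open subset of the sphere, because the
cone over such a set, without its apex, is open in the ambient space and has positive volume.  So the
integral of a nonnegative continuous function can only vanish if the function does.
\<close>
lemma set_integral_spherical_measure_pos:
  fixes h :: "real ^ 'n::finite \<Rightarrow> real"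
  assumes cont: "continuous_on (sphere 0 1) h"
    and nonneg: "\<And>u. u \<in> sphere 0 1 \<Longrightarrow> 0 \<le> h u"
    and v: "v \<in> sphere 0 1" "0 < h v"
  shows "0 < (LINT u:sphere 0 1|spherical_measure. h u)"
proof (rule ccontr)
  let ?h = "\<lambda>u. indicator (sphere 0 1) u *\<^sub>R h u"
  let ?N = "{u. ?h u \<noteq> 0}"
  \<comment> \<open>The open cone over the part of the sphere where \<open>h\<close> is positive: it cannot be Lebesgue-null.\<close>
  let ?A = "(ball 0 1 - {0}) \<inter> (h \<circ> sgn) -` {0<..}"
  assume "\<not> 0 < (LINT u:sphere 0 1|spherical_measure. h u)"
  moreover have "0 \<le> (LINT u:sphere 0 1|spherical_measure. h u)"
    unfolding set_lebesgue_integral_def using nonneg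
    by (intro integral_nonneg_AE) (auto simp: indicator_def)
  ultimately have "integral\<^sup>L spherical_measure ?h = 0"
    by (simp add: set_lebesgue_integral_def)
  moreover have "integrable spherical_measure ?h"
    using set_integrable_spherical_measure[OF cont] by (simp add: set_integrable_def)
  ultimately have AE: "AE u in spherical_measure. ?h u = 0"
    using nonneg by (subst (asm) integral_nonneg_eq_0_iff_AE) (auto simp: indicator_def)
  have "?h \<in> borel_measurable borel"
    by (rule borel_measurable_continuous_on_indicator[OF _ cont]) auto
  then have N: "?N \<in> sets borel" by measurable
  have "emeasure spherical_measure ?N = 0"
    using AE by (subst (asm) AE_iff_measurable[where N = "?N"]) (use N in auto)
  then have "emeasure lborel (sgn -` ?N \<inter> (cball 0 1 - {0})) = 0"
    using emeasure_spherical_measure[OF N] by (simp only: mult_eq_0_iff) simp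
  moreover have "sgn -` ?N \<inter> (cball 0 1 - {0}) \<in> sets lborel"
    using measurable_sets[OF borel_measurable_sgn N] by auto
  ultimately have "negligible (sgn -` ?N \<inter> (cball 0 1 - {0}))"
    by (simp add: negligible_iff_null_sets null_sets_completionI null_setsI)
  moreover have "?A \<subseteq> sgn -` ?N \<inter> (cball 0 1 - {0})"
    by (auto simp: norm_sgn)
  ultimately have "negligible ?A" using negligible_subset by blast
  moreover have "open ?A"
  proof (rule continuous_open_preimage)
    show "continuous_on (ball 0 1 - {0}) (h \<circ> sgn)"
      by (intro continuous_on_compose continuous_on_subset[OF cont] continuous_intros)
        (auto simp: norm_sgn split: if_splits)
  qed auto
  moreover have "sgn v = v" using v by (simp add: sgn_div_norm)
  then have "(1/2) *\<^sub>R v \<in> ?A" using v by (auto simp: sgn_scaleR)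
  ultimately show False using open_not_negligible by blast
qed

section \<open>The dual Steiner polynomial as a single integral\<close>

text \<open>
The binomial theorem under the integral sign.  This closed form replaces the individual dual
quermassintegrals everywhere below.
\<close>
lemma dual_steiner_poly_eq_integral:
  fixes K L :: "(real ^ 'n::finite) set"
  assumes "star_body K" "star_body L"
  shows "dual_steiner_poly K L z = of_real (1 / real CARD('n)) *
    (LINT u:sphere 0 1|spherical_measure.
      (of_real (radial K u) + z * of_real (radial L u)) ^ CARD('n))"
proof -
  let ?n = "CARD('n)"
  let ?W = "\<lambda>i u. radial K u powr (real ?n - real i) * radial L u powr real i"
  let ?c = "\<lambda>i. of_nat (?n choose i) * z ^ i"
  have contK: "continuous_on (sphere 0 1) (radial K)" and contL: "continuous_on (sphere 0 1) (radial L)"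
    and posK: "\<And>u. u \<in> sphere 0 1 \<Longrightarrow> 0 < radial K u"
    and posL: "\<And>u. u \<in> sphere 0 1 \<Longrightarrow> 0 < radial L u"
    using assms by (auto simp: star_body_def)
  have contW: "continuous_on (sphere 0 1) (?W i)" for i
    using posK posL by (intro continuous_intros contK contL) force+
  have int: "integrable spherical_measure
      (\<lambda>u. indicator (sphere 0 1) u *\<^sub>R (?c i * of_real (?W i u)))" for i
    unfolding set_integrable_def[symmetric]
    by (intro set_integrable_spherical_measure continuous_on_mult continuous_on_const
        continuous_on_of_real contW)
  have expand: "indicator (sphere 0 1) u *\<^sub>R (of_real (radial K u) + z * of_real (radial L u)) ^ ?n
      = (\<Sum>i\<le>?n. indicator (sphere 0 1) u *\<^sub>R (?c i * of_real (?W i u)))" for u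
  proof (cases "u \<in> sphere 0 1")
    case True
    have W: "?W i u = radial K u ^ (?n - i) * radial L u ^ i" if "i \<le> ?n" for i
      using posK[OF True] posL[OF True] that
      by (simp add: powr_realpow flip: of_nat_diff)
    have "(of_real (radial K u) + z * of_real (radial L u)) ^ ?n
        = (\<Sum>i\<le>?n. ?c i * of_real (?W i u))"
      by (subst add.commute, subst binomial_ring) (auto intro!: sum.cong simp: W power_mult_distrib)
    with True show ?thesis by (simp add: scaleR_sum_right)
  qed (simp add: indicator_def)
  have "(LINT u:sphere 0 1|spherical_measure.
      (of_real (radial K u) + z * of_real (radial L u)) ^ ?n)
    = (\<Sum>i\<le>?n. LINT u:sphere 0 1|spherical_measure. ?c i * of_real (?W i u))"
    unfolding set_lebesgue_integral_def expand using int by (intro Bochner_Integration.integral_sum) auto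
  also have "\<dots> = (\<Sum>i\<le>?n. ?c i * of_real (LINT u:sphere 0 1|spherical_measure. ?W i u))"
    by (simp only: set_integral_mult_right set_integral_complex_of_real)
  finally show ?thesis
    unfolding dual_steiner_poly_def dual_quermassintegral_def atLeast0AtMost
    by (simp add: sum_distrib_left sum_divide_distrib mult_ac)
qed

section \<open>Star bodies with prescribed radial function\<close>

text \<open>
Written as a continuous image of a compact product, rather than as a sublevel set of a gauge, so
that compactness is immediate.
\<close>
definition body_of_radial :: "(real ^ 'n::finite \<Rightarrow> real) \<Rightarrow> (real ^ 'n) set" where
  "body_of_radial \<rho> = (\<lambda>(t, u). (t * \<rho> u) *\<^sub>R u) ` ({0..1} \<times> sphere 0 1)"

lemma radial_body_of_radial:
  fixes \<rho> :: "real ^ 'n::finite \<Rightarrow> real"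
  assumes "\<forall>u\<in>sphere 0 1. 0 < \<rho> u" and u: "u \<in> sphere 0 1"
  shows "radial (body_of_radial \<rho>) u = \<rho> u"
  unfolding radial_def
proof (rule Greatest_equality)
  have "\<rho> u *\<^sub>R u \<in> body_of_radial \<rho>"
    unfolding body_of_radial_def using u by (intro image_eqI[where x = "(1, u)"]) auto
  then show "0 \<le> \<rho> u \<and> \<rho> u *\<^sub>R u \<in> body_of_radial \<rho>"
    using assms by (simp add: less_imp_le)
next
  fix l assume l: "0 \<le> l \<and> l *\<^sub>R u \<in> body_of_radial \<rho>"
  then obtain t v where t: "0 \<le> t" "t \<le> 1" and v: "v \<in> sphere 0 1"
    and eq: "l *\<^sub>R u = (t * \<rho> v) *\<^sub>R v"
    by (auto simp: body_of_radial_def)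
  have pos: "0 < \<rho> u" "0 < \<rho> v" using assms v by blast+
  from arg_cong[OF eq, of norm] have l_eq: "l = t * \<rho> v"
    using u v l t pos by (simp add: abs_mult)
  show "l \<le> \<rho> u"
  proof (cases "l = 0")
    case False
    with eq l_eq have "u = v" by simp
    with l_eq t pos show ?thesis
      by (simp add: mult_left_le_one_le)
  qed (use pos in simp)
qed

lemma star_body_body_of_radial:
  fixes \<rho> :: "real ^ 'n::finite \<Rightarrow> real"
  assumes cont: "continuous_on (sphere 0 1) \<rho>" and pos: "\<forall>u\<in>sphere 0 1. 0 < \<rho> u"
  shows "star_body (body_of_radial \<rho>)"
  unfolding star_body_def
proof (intro conjI ballI)
  have "continuous_on ({0..1} \<times> sphere 0 1) (\<lambda>p. \<rho> (snd p))"
    by (intro continuous_on_compose2[OF cont] continuous_intros) auto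
  then have "continuous_on ({0..1} \<times> sphere 0 1) (\<lambda>(t, u). (t * \<rho> u) *\<^sub>R u)"
    unfolding case_prod_beta by (intro continuous_intros)
  then show "compact (body_of_radial \<rho>)"
    unfolding body_of_radial_def by (intro compact_continuous_image compact_Times) auto
  show "body_of_radial \<rho> \<noteq> {}"
    by (simp add: body_of_radial_def)
  show "closed_segment 0 x \<subseteq> body_of_radial \<rho>" if "x \<in> body_of_radial \<rho>" for x
  proof
    fix y assume "y \<in> closed_segment 0 x"
    then obtain s where s: "0 \<le> s" "s \<le> 1" "y = s *\<^sub>R x"
      by (auto simp: in_segment)
    from that obtain t v where "0 \<le> t" "t \<le> 1" "v \<in> sphere 0 1" "x = (t * \<rho> v) *\<^sub>R v"
      by (auto simp: body_of_radial_def)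
    with s show "y \<in> body_of_radial \<rho>"
      unfolding body_of_radial_def
      by (intro image_eqI[where x = "(s * t, v)"]) (auto simp: mult_le_one)
  qed
  show "0 < radial (body_of_radial \<rho>) u" if "u \<in> sphere 0 1" for u
    using that pos by (simp add: radial_body_of_radial[OF pos])
  show "continuous_on (sphere 0 1) (radial (body_of_radial \<rho>))"
    using cont by (rule continuous_on_eq) (simp add: radial_body_of_radial[OF pos])
qed

section \<open>Integrals that vanish for a suitable weight\<close>

text \<open>
The values of the integral for all positive weights form a convex set.  If it missed the origin, a
separating functional would be nonnegative on all of them.  By assumption the functional is negative
at some value of \<open>g\<close>, and a weight concentrated on such points gives a contradiction.
\<close>
lemma exists_weight_set_integral_zero:
  fixes g :: "real ^ 'n::finite \<Rightarrow> complex"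
  assumes cont: "continuous_on (sphere 0 1) g"
    and no_halfspace: "\<And>a. a \<noteq> 0 \<Longrightarrow> \<exists>u\<in>sphere 0 1. inner a (g u) < 0"
  shows "\<exists>w. continuous_on (sphere 0 1) w \<and> (\<forall>u\<in>sphere 0 1. 0 < w u) \<and>
    (LINT u:sphere 0 1|spherical_measure. w u *\<^sub>R g u) = 0"
proof (rule ccontr)
  define P where "P = {w :: real ^ 'n \<Rightarrow> real. continuous_on (sphere 0 1) w \<and> (\<forall>u\<in>sphere 0 1. 0 < w u)}"
  define J where "J w = (LINT u:sphere 0 1|spherical_measure. w u *\<^sub>R g u)" for w
  assume "\<not> ?thesis"
  then have no_zero: "0 \<notin> J ` P" by (auto simp: P_def J_def)
  have int: "set_integrable spherical_measure (sphere 0 1) (\<lambda>u. w u *\<^sub>R g u)"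
    if "continuous_on (sphere 0 1) w" for w
    by (intro set_integrable_spherical_measure continuous_intros that cont)
  have "convex (J ` P)"
  proof (rule convexI, safe)
    fix w1 w2 and s t :: real
    assume w: "w1 \<in> P" "w2 \<in> P" and st: "0 \<le> s" "0 \<le> t" "s + t = 1"
    let ?w = "\<lambda>u. s * w1 u + t * w2 u"
    have "0 < ?w u" if "u \<in> sphere 0 1" for u
    proof (cases "s = 0")
      case False
      with st that w show ?thesis
        by (intro add_pos_nonneg mult_pos_pos mult_nonneg_nonneg) (auto simp: P_def less_imp_le)
    qed (use st that w in \<open>auto simp: P_def\<close>)
    then have "?w \<in> P"
      using w by (auto simp: P_def intro!: continuous_intros)
    moreover have "J ?w = s *\<^sub>R J w1 + t *\<^sub>R J w2"
    proof -
      have "J ?w = (LINT u:sphere 0 1|spherical_measure. s *\<^sub>R (w1 u *\<^sub>R g u) + t *\<^sub>R (w2 u *\<^sub>R g u))"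
        unfolding J_def by (simp only: scaleR_add_left scaleR_scaleR)
      also have "\<dots> = (LINT u:sphere 0 1|spherical_measure. s *\<^sub>R (w1 u *\<^sub>R g u))
          + (LINT u:sphere 0 1|spherical_measure. t *\<^sub>R (w2 u *\<^sub>R g u))"
        using w by (intro set_integral_add set_integrable_spherical_measure continuous_intros cont)
          (auto simp: P_def)
      also have "\<dots> = s *\<^sub>R J w1 + t *\<^sub>R J w2"
        unfolding J_def set_lebesgue_integral_def by (simp only: scaleR_left_commute integral_scaleR_right)
      finally show ?thesis .
    qed
    ultimately show "s *\<^sub>R J w1 + t *\<^sub>R J w2 \<in> J ` P" 
      by (intro image_eqI[where x = ?w]) (simp_all only:)
  qed
  from separating_hyperplane_set_0[OF this no_zero] obtain a
    where a: "a \<noteq> 0" and sep: "\<And>w. w \<in> P \<Longrightarrow> 0 \<le> inner a (J w)" by auto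
  \<comment> \<open>If \<open>h\<close> is negative somewhere, a weight concentrated on \<open>h < 0\<close> violates the separation.
      The negative part of \<open>h\<close> is such a weight; \<open>\<epsilon>\<close> makes it strictly positive at negligible cost.\<close>
  define h where "h u = inner a (g u)" for u
  have conth: "continuous_on (sphere 0 1) h"
    unfolding h_def by (intro continuous_intros cont)
  from no_halfspace[OF a] obtain v where v: "v \<in> sphere 0 1" "h v < 0"
    by (auto simp: h_def)
  define p where "p = (LINT u:sphere 0 1|spherical_measure. (max (- h u) 0)\<^sup>2)"
  define q where "q = (LINT u:sphere 0 1|spherical_measure. h u)"
  define \<epsilon> where "\<epsilon> = p / (\<bar>q\<bar> + 1)"
  have "0 < p"
    unfolding p_def using v
    by (intro set_integral_spherical_measure_pos[where v = v] continuous_intros conth) auto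
  then have \<epsilon>: "0 < \<epsilon>" by (simp add: \<epsilon>_def)
  let ?w = "\<lambda>u. max (- h u) 0 + \<epsilon>"
  have w: "?w \<in> P"
    using \<epsilon> by (auto simp: P_def intro!: continuous_intros conth add_nonneg_pos)
  have "inner a (J ?w) = (LINT u:sphere 0 1|spherical_measure. inner a (?w u *\<^sub>R g u))"
    unfolding J_def set_lebesgue_integral_def
    using int[of ?w] w by (subst integral_inner_right[symmetric]) (auto simp: P_def set_integrable_def mult.assoc)
  also have "\<dots> = (LINT u:sphere 0 1|spherical_measure. \<epsilon> * h u - (max (- h u) 0)\<^sup>2)"
    by (rule arg_cong[where f = "set_lebesgue_integral _ _"])
      (auto simp: fun_eq_iff h_def max_def power2_eq_square algebra_simps)
  also have "\<dots> = (LINT u:sphere 0 1|spherical_measure. \<epsilon> * h u) - p"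
    unfolding p_def
    by (intro set_integral_diff set_integrable_spherical_measure continuous_intros conth)
  also have "\<dots> = \<epsilon> * q - p" by (simp add: q_def)
  also have "\<dots> < 0"
  proof -
    have "\<epsilon> * q \<le> \<epsilon> * \<bar>q\<bar>" using \<epsilon> by (intro mult_left_mono) auto
    also have "\<dots> < \<epsilon> * (\<bar>q\<bar> + 1)" using \<epsilon> by simp
    also have "\<dots> = p" by (simp add: \<epsilon>_def add_nonneg_eq_0_iff)
    finally show ?thesis by simp
  qed
  finally show False using sep[OF w] by simp
qed

section \<open>Arguments at most \<open>pi / n\<close>: no roots\<close>

text \<open>
The sum of \<open>a\<close> and \<open>z * b\<close> lies strictly between the directions of \<open>1\<close> and \<open>z\<close>, so its
argument is in the open interval from \<open>0\<close> to \<open>pi / n\<close>, and taking the \<open>n\<close>-th power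
leaves it in the open upper half-plane.
The strictness is what excludes the ray of argument exactly \<open>pi / n\<close> from the root set.
\<close>
lemma Im_shifted_power_pos:
  assumes z: "0 < Im z" and n: "0 < n" "Arg z \<le> pi / real n" and ab: "0 < a" "0 < b"
  shows "0 < Im ((of_real a + z * of_real b) ^ n)"
proof -
  define v where "v = of_real a + z * of_real b"
  have Im_v: "0 < Im v" using z ab by (simp add: v_def)
  then have arg_v: "0 < Arg v" "Arg v < pi" using Arg_lt_pi by blast+
  have arg_z: "0 < Arg z" "Arg z < pi" using z Arg_lt_pi by blast+
  have v: "v = rcis (norm v) (Arg v)" and z_rcis: "z = rcis (norm z) (Arg z)"
    by (simp_all add: rcis_cmod_Arg)
  \<comment> \<open>Adding a positive real turns a point of the upper half-plane clockwise.\<close>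
  have "Arg v < Arg z"
  proof (rule ccontr)
    assume "\<not> Arg v < Arg z"
    then have "0 \<le> sin (Arg v - Arg z)" using arg_v arg_z by (intro sin_ge_zero) auto
    then have "0 \<le> norm v * norm z * sin (Arg v - Arg z)" by simp
    also have "\<dots> = Im (rcis (norm v) (Arg v) * cnj (rcis (norm z) (Arg z)))"
      by (simp add: sin_diff algebra_simps)
    also have "\<dots> = Im (v * cnj z)" using v z_rcis by simp
    also have "\<dots> = - (a * Im z)" by (simp add: v_def algebra_simps)
    finally show False using z ab by (simp add: mult_le_0_iff)
  qed
  then have "real n * Arg v < real n * Arg z" using n by simp
  also have "\<dots> \<le> pi" using n by (simp add: field_simps)
  finally have "0 < sin (real n * Arg v)" using n arg_v by (intro sin_gt_zero) auto
  moreover have "Im (v ^ n) = norm v ^ n * sin (real n * Arg v)"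
    by (subst v) (simp add: DeMoivre2)
  moreover have "v \<noteq> 0" using Im_v by auto
  ultimately show ?thesis by (simp add: v_def)
qed

text \<open>
All values of the integrand lie in one open half-plane with the origin on its boundary: the upper one if
\<open>z\<close> is not real, the right one if \<open>z\<close> is a nonnegative real.
\<close>
lemma dual_steiner_poly_nonzero:
  fixes K L :: "(real ^ 'n::finite) set"
  assumes n: "2 \<le> CARD('n)" and star: "star_body K" "star_body L"
    and z: "0 \<le> Im z" "Arg z \<le> pi / real CARD('n)"
  shows "dual_steiner_poly K L z \<noteq> 0"
proof -
  let ?n = "CARD('n)"
  let ?F = "\<lambda>u. (of_real (radial K u) + z * of_real (radial L u)) ^ ?n"
  have contK: "continuous_on (sphere 0 1) (radial K)" and contL: "continuous_on (sphere 0 1) (radial L)"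
    and posK: "\<And>u. u \<in> sphere 0 1 \<Longrightarrow> 0 < radial K u"
    and posL: "\<And>u. u \<in> sphere 0 1 \<Longrightarrow> 0 < radial L u"
    using star by (auto simp: star_body_def)
  have contF: "continuous_on (sphere 0 1) ?F"
    by (intro continuous_intros contK contL)
  obtain v :: "real ^ 'n" where v: "v \<in> sphere 0 1"
    using vector_choose_size[of 1] by auto
  obtain a where a: "\<And>u. u \<in> sphere 0 1 \<Longrightarrow> 0 < inner a (?F u)"
  proof (cases "Im z = 0")
    case True
    have "pi / real ?n < pi" using n by (simp add: field_simps)
    with z True have "0 \<le> Re z" using Arg_eq_pi[of z] by force
    have z_eq: "z = of_real (Re z)" using True by (simp add: complex_eq_iff)
    show ?thesis
    proof (rule that[of 1])
      fix u :: "real ^ 'n" assume u: "u \<in> sphere 0 1"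
      have "?F u = of_real ((radial K u + Re z * radial L u) ^ ?n)"
        by (subst z_eq) simp
      moreover have "0 < radial K u + Re z * radial L u"
        using posK[OF u] posL[OF u] \<open>0 \<le> Re z\<close> by (intro add_pos_nonneg) auto
      ultimately show "0 < inner 1 (?F u)" by (simp add: inner_complex_def del: of_real_power)
    qed
  next
    case False
    then show ?thesis
      using z n by (intro that[of \<i>])
        (auto simp: inner_complex_def intro!: Im_shifted_power_pos posK posL)
  qed
  have "0 < (LINT u:sphere 0 1|spherical_measure. inner a (?F u))"
    using a v by (intro set_integral_spherical_measure_pos[where v = v])
      (auto intro!: continuous_intros contF contK contL less_imp_le)
  also have "\<dots> = inner a (LINT u:sphere 0 1|spherical_measure. ?F u)"
    using set_integrable_spherical_measure[OF contF]
    unfolding set_lebesgue_integral_def set_integrable_def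
    by (subst integral_inner_right[symmetric]) auto
  finally show ?thesis
    by (auto simp: dual_steiner_poly_eq_integral[OF star])
qed

section \<open>Arguments greater than \<open>pi / n\<close>: every point is a root\<close>

lemma dual_steiner_rootI:
  fixes \<rho> \<tau> :: "real ^ 'n::finite \<Rightarrow> real"
  assumes \<rho>: "continuous_on (sphere 0 1) \<rho>" "\<forall>u\<in>sphere 0 1. 0 < \<rho> u"
    and \<tau>: "continuous_on (sphere 0 1) \<tau>" "\<forall>u\<in>sphere 0 1. 0 < \<tau> u"
    and "0 \<le> Im z"
    and zero: "(LINT u:sphere 0 1|spherical_measure.
      (of_real (\<rho> u) + z * of_real (\<tau> u)) ^ CARD('n)) = 0"
  shows "z \<in> dual_steiner_roots TYPE('n)"
proof -
  let ?K = "body_of_radial \<rho>" and ?L = "body_of_radial \<tau>"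
  have star: "star_body ?K" "star_body ?L"
    using \<rho> \<tau> by (auto intro: star_body_body_of_radial)
  have "(LINT u:sphere 0 1|spherical_measure.
      (of_real (radial ?K u) + z * of_real (radial ?L u)) ^ CARD('n)) = 0"
    unfolding zero[symmetric]
    by (rule set_lebesgue_integral_cong)
      (auto simp: radial_body_of_radial[OF \<rho>(2)] radial_body_of_radial[OF \<tau>(2)])
  then have "dual_steiner_poly ?K ?L z = 0"
    by (simp add: dual_steiner_poly_eq_integral[OF star])
  with star \<open>0 \<le> Im z\<close> show ?thesis by (auto simp: dual_steiner_roots_def)
qed

text \<open>
An affine function of one coordinate.  The dimension enters here: from dimension two on the
sphere is connected, so the coordinate takes all values between its extremes.
\<close>
lemma exists_continuous_on_sphere_covering:
  assumes n: "2 \<le> CARD('n::finite)" and mM: "0 < m" "m \<le> M"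
  shows "\<exists>\<xi> :: real ^ 'n \<Rightarrow> real. continuous_on (sphere 0 1) \<xi> \<and>
    (\<forall>u\<in>sphere 0 1. 0 < \<xi> u) \<and> {m..M} \<subseteq> \<xi> ` sphere 0 1"
proof -
  obtain k :: 'n where "k \<in> UNIV" by simp
  define \<xi> :: "real ^ 'n \<Rightarrow> real" where "\<xi> u = m + (M - m) * ((1 + u $ k) / 2)" for u
  have cont: "continuous_on (sphere 0 1) \<xi>"
    unfolding \<xi>_def by (intro continuous_intros) auto
  have "0 < \<xi> u" if "u \<in> sphere 0 1" for u
  proof -
    have "\<bar>u $ k\<bar> \<le> 1" using component_le_norm_cart[of u k] that by simp
    then show ?thesis unfolding \<xi>_def using mM by (intro add_pos_nonneg mult_nonneg_nonneg) auto
  qed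
  moreover have "{m..M} \<subseteq> \<xi> ` sphere 0 1"
  proof (rule connected_contains_Icc)
    show "connected (\<xi> ` sphere 0 1)"
      using n by (intro connected_continuous_image cont connected_sphere) simp
    show "m \<in> \<xi> ` sphere 0 1"
      by (rule image_eqI[where x = "- axis k 1"]) (auto simp: \<xi>_def)
    show "M \<in> \<xi> ` sphere 0 1"
      by (rule image_eqI[where x = "axis k 1"]) (auto simp: \<xi>_def)
  qed
  ultimately show ?thesis using cont by blast
qed

text \<open>
As \<open>x\<close> runs through the positive reals, the argument of \<open>x + z\<close> runs through the open
interval from \<open>0\<close> to \<open>Arg z\<close>, so the direction of the \<open>n\<close>-th power sweeps an angle larger
than \<open>pi\<close>, which no closed half-plane contains.
Four values of \<open>x\<close> suffice as witnesses, two pairs of opposite directions on different lines;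
therefore \<open>x\<close> may be confined to a compact interval of positive reals.
\<close>
lemma shifted_powers_not_in_halfspace:
  assumes z: "0 < Im z" and n: "0 < n" "pi / real n < Arg z"
  shows "\<exists>m M. 0 < m \<and> m \<le> M \<and>
    (\<forall>a::complex. a \<noteq> 0 \<longrightarrow> (\<exists>x\<in>{m..M}. inner a ((of_real x + z) ^ n) < 0))"
proof -
  define \<theta> where "\<theta> = Arg z"
  have \<theta>: "pi / real n < \<theta>" "\<theta> < pi" "0 < \<theta>" using n z Arg_lt_pi[of z] by (auto simp: \<theta>_def)
  have z_rcis: "z = rcis (norm z) \<theta>" by (simp add: \<theta>_def rcis_cmod_Arg)
  have Im_z: "Im z = norm z * sin \<theta>" and Re_z: "Re z = norm z * cos \<theta>"
    using arg_cong[OF z_rcis, of Im] arg_cong[OF z_rcis, of Re] by simp_all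
  have "z \<noteq> 0" using z by auto
  \<comment> \<open>The horizontal ray from \<open>z\<close> to the right meets the direction \<open>\<phi>\<close> at \<open>x \<phi> + z\<close>.\<close>
  define x where "x \<phi> = norm z * sin (\<theta> - \<phi>) / sin \<phi>" for \<phi>
  have x_pos: "0 < x \<phi>" and dir: "of_real (x \<phi>) + z = rcis (Im z / sin \<phi>) \<phi>" and
    sin_pos: "0 < sin \<phi>" if "0 < \<phi>" "\<phi> < \<theta>" for \<phi>
  proof -
    show s: "0 < sin \<phi>" using that \<theta> by (intro sin_gt_zero) auto
    moreover have "0 < sin (\<theta> - \<phi>)" using that \<theta> by (intro sin_gt_zero) auto
    ultimately show "0 < x \<phi>" using \<open>z \<noteq> 0\<close> by (simp add: x_def)
    show "of_real (x \<phi>) + z = rcis (Im z / sin \<phi>) \<phi>"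
      using s by (auto simp: complex_eq_iff x_def Im_z Re_z sin_diff field_simps)
  qed
  \<comment> \<open>The first bound keeps the four angles of \<open>S\<close> below \<open>\<theta>\<close>; the second makes the directions
      \<open>n * \<delta>\<close> and \<open>2 * n * \<delta>\<close> linearly independent.\<close>
  define \<delta> where "\<delta> = min ((\<theta> - pi / real n) / 3) (pi / (2 * real n))"
  have \<delta>: "0 < \<delta>" "\<delta> \<le> (\<theta> - pi / real n) / 3" "\<delta> \<le> pi / (2 * real n)"
  proof -
    show "0 < \<delta>" using \<theta> n by (simp add: \<delta>_def)
  qed (unfold \<delta>_def, rule min.cobounded1, rule min.cobounded2)
  define S where "S = {\<delta>, 2 * \<delta>, \<delta> + pi / real n, 2 * \<delta> + pi / real n}"
  have S: "0 < \<phi>" "\<phi> < \<theta>" if "\<phi> \<in> S" for \<phi>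
  proof -
    have "0 < pi / real n" using n by simp
    then show "0 < \<phi>" "\<phi> < \<theta>" using that \<delta> unfolding S_def by auto
  qed
  define m M where "m = Min (x ` S)" and "M = Max (x ` S)"
  have fin: "finite (x ` S)" "x ` S \<noteq> {}" by (auto simp: S_def)
  have x_range: "x \<phi> \<in> {m..M}" if "\<phi> \<in> S" for \<phi>
    using that fin unfolding m_def M_def by auto
  have "0 < m" unfolding m_def using fin S x_pos by (subst Min_gr_iff) auto
  moreover have "m \<le> M" using x_range[of \<delta>] by (auto simp: S_def)
  moreover have "\<exists>y\<in>{m..M}. inner a ((of_real y + z) ^ n) < 0" if "a \<noteq> 0" for a
  proof (rule ccontr)
    assume no: "\<not> ?thesis"
    have nonneg: "0 \<le> inner a (cis (real n * \<phi>))" if "\<phi> \<in> S" for \<phi>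
    proof -
      have "0 \<le> inner a ((of_real (x \<phi>) + z) ^ n)"
        using no x_range[OF that] by (meson not_less)
      also have "\<dots> = (Im z / sin \<phi>) ^ n * inner a (cis (real n * \<phi>))"
        by (simp only: dir[OF S[OF that]] DeMoivre2) (simp add: inner_complex_def algebra_simps)
      finally have "0 \<le> (Im z / sin \<phi>) ^ n * inner a (cis (real n * \<phi>))" .
      moreover have "0 < (Im z / sin \<phi>) ^ n"
        using z sin_pos[OF S[OF that]] by simp
      ultimately show ?thesis by (metis not_less mult_pos_neg)
    qed
    \<comment> \<open>Angles that differ by \<open>pi / n\<close> give opposite directions, so both inner products vanish.\<close>
    have zero: "inner a (cis (real n * \<phi>)) = 0" if "\<phi> \<in> S" "\<phi> + pi / real n \<in> S" for \<phi>
    proof -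
      have "real n * (\<phi> + pi / real n) = real n * \<phi> + pi" using n by (simp add: field_simps)
      then have "cis (real n * (\<phi> + pi / real n)) = - cis (real n * \<phi>)"
        by (simp add: complex_eq_iff)
      with nonneg[OF that(1)] nonneg[OF that(2)] show ?thesis by simp
    qed
    define \<psi> where "\<psi> = real n * \<delta>"
    have "0 < \<psi>" "\<psi> \<le> pi / 2" using \<delta> n by (auto simp: \<psi>_def field_simps)
    then have s: "0 < sin \<psi>" by (intro sin_gt_zero) (auto intro: le_less_trans)
    have e1: "Re a * cos \<psi> + Im a * sin \<psi> = 0"
      using zero[of \<delta>] by (simp add: S_def \<psi>_def inner_complex_def)
    have e2: "Re a * cos (2 * \<psi>) + Im a * sin (2 * \<psi>) = 0"
      using zero[of "2 * \<delta>"] by (simp add: S_def \<psi>_def inner_complex_def mult_ac)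
    have "Re a = Re a * ((sin \<psi>)\<^sup>2 + (cos \<psi>)\<^sup>2)" by simp
    also have "\<dots> = 2 * cos \<psi> * (Re a * cos \<psi> + Im a * sin \<psi>)
        - (Re a * cos (2 * \<psi>) + Im a * sin (2 * \<psi>))"
      unfolding cos_double sin_double by algebra
    finally have "Re a = 0" by (simp add: e1 e2)
    with e1 s have "a = 0" by (simp add: complex_eq_iff)
    with that show False by simp
  qed
  ultimately show ?thesis by blast
qed

text \<open>
A negative real \<open>z\<close> is a root for two concentric balls with ratio of radii \<open>- z\<close>.  Otherwise
\<open>\<xi>\<close> prescribes the ratio of the two radial functions, and the weight that makes the integral
vanish determines the second one.
\<close>
lemma dual_steiner_root_of_Arg_greater:
  assumes n: "2 \<le> CARD('n::finite)" and z: "pi / real CARD('n) < Arg z"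
  shows "z \<in> dual_steiner_roots TYPE('n)"
proof -
  let ?n = "CARD('n)"
  have "0 < pi / real ?n" by simp
  with z have arg_pos: "0 < Arg z" by linarith
  then have Im_z: "0 \<le> Im z" using Arg_less_0[of z] by simp
  show ?thesis
  proof (cases "Im z = 0")
    case True
    with arg_pos have "Re z < 0" using Arg_pos_iff by auto
    from True have "of_real (- Re z) + z * of_real 1 = 0"
      by (simp add: complex_eq_iff)
    then have "(LINT u:sphere 0 1|spherical_measure :: (real ^ 'n) measure.
        (of_real (- Re z) + z * of_real 1) ^ ?n) = 0"
      by (simp only: power_0_left) simp
    with \<open>Re z < 0\<close> Im_z show ?thesis
      by (intro dual_steiner_rootI[where \<rho> = "\<lambda>_. - Re z" and \<tau> = "\<lambda>_. 1"]) auto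
  next
    case False
    then obtain m M where mM: "0 < m" "m \<le> M"
      and neg: "\<And>a. a \<noteq> 0 \<Longrightarrow> \<exists>x\<in>{m..M}. inner a ((of_real x + z) ^ ?n) < 0"
      using shifted_powers_not_in_halfspace[of z ?n] z Im_z by auto
    obtain \<xi> :: "real ^ 'n \<Rightarrow> real" where \<xi>: "continuous_on (sphere 0 1) \<xi>"
      "\<And>u. u \<in> sphere 0 1 \<Longrightarrow> 0 < \<xi> u" and cover: "{m..M} \<subseteq> \<xi> ` sphere 0 1"
      using exists_continuous_on_sphere_covering[OF n mM] by blast
    have "\<exists>u\<in>sphere 0 1. inner a ((of_real (\<xi> u) + z) ^ ?n) < 0" if "a \<noteq> 0" for a
      using neg[OF that] cover by blast
    then obtain w where w: "continuous_on (sphere 0 1) w" "\<And>u. u \<in> sphere 0 1 \<Longrightarrow> 0 < w u"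
      and zero: "(LINT u:sphere 0 1|spherical_measure. w u *\<^sub>R (of_real (\<xi> u) + z) ^ ?n) = 0"
      using exists_weight_set_integral_zero[of "\<lambda>u. (of_real (\<xi> u) + z) ^ ?n"] \<xi>
      by (force intro!: continuous_intros)
    \<comment> \<open>With this radial function for \<open>L\<close> and \<open>\<xi> * \<tau>\<close> for \<open>K\<close> the weight \<open>w\<close> becomes \<open>\<tau> ^ n\<close>.\<close>
    define \<tau> where "\<tau> u = root ?n (w u)" for u
    have \<tau>: "continuous_on (sphere 0 1) \<tau>" "\<And>u. u \<in> sphere 0 1 \<Longrightarrow> 0 < \<tau> u"
      unfolding \<tau>_def using w by (auto intro!: continuous_intros)
    show ?thesis
    proof (rule dual_steiner_rootI)
      show "continuous_on (sphere 0 1) (\<lambda>u. \<xi> u * \<tau> u)" by (intro continuous_intros \<xi> \<tau>)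
      show "\<forall>u\<in>sphere 0 1. 0 < \<xi> u * \<tau> u" using \<xi>(2) \<tau>(2) by simp
      have "(of_real (\<xi> u * \<tau> u) + z * of_real (\<tau> u)) ^ ?n = w u *\<^sub>R (of_real (\<xi> u) + z) ^ ?n"
        if "u \<in> sphere 0 1" for u
      proof -
        have "of_real (\<xi> u * \<tau> u) + z * of_real (\<tau> u) = of_real (\<tau> u) * (of_real (\<xi> u) + z)"
          by (simp add: algebra_simps)
        moreover have "\<tau> u ^ ?n = w u"
          unfolding \<tau>_def using w(2)[OF that] by (intro real_root_pow_pos2) auto
        ultimately show ?thesis
          by (simp add: power_mult_distrib scaleR_conv_of_real flip: of_real_power)
      qed
      then show "(LINT u:sphere 0 1|spherical_measure.
          (of_real (\<xi> u * \<tau> u) + z * of_real (\<tau> u)) ^ ?n) = 0"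
        unfolding zero[symmetric] by (intro set_lebesgue_integral_cong) auto
    qed (use \<tau> Im_z in auto)
  qed
qed

lemma dual_steiner_roots_eq:
  assumes "2 \<le> CARD('n::finite)"
  shows "dual_steiner_roots TYPE('n) = {z. pi / real CARD('n) < Arg z}"
proof (intro equalityI subsetI)
  fix z assume "z \<in> dual_steiner_roots TYPE('n)"
  then show "z \<in> {z. pi / real CARD('n) < Arg z}"
    using dual_steiner_poly_nonzero[OF assms] by (force simp: dual_steiner_roots_def)
qed (use dual_steiner_root_of_Arg_greater[OF assms] in auto)

section \<open>Geometry of the cone of large arguments\<close>

text \<open>
The cone of arguments above \<open>c\<close> as the intersection of a closed and an open half-plane, in the
inner-product form that the facts about convexity, interior and closure of half-spaces use.
\<close>
lemma Arg_greater_iff_halfplanes: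
  assumes c: "0 < c" "c < pi"
  shows "c < Arg z \<longleftrightarrow> 0 \<le> inner \<i> z \<and> 0 < inner (\<i> * cis c) z"
proof -
  have "z = rcis (norm z) (Arg z)" by (simp add: rcis_cmod_Arg)
  then have "inner (\<i> * cis c) z = inner (\<i> * cis c) (rcis (norm z) (Arg z))" by simp
  also have "\<dots> = norm z * sin (Arg z - c)"
    by (simp add: inner_complex_def sin_diff algebra_simps)
  finally have eq: "inner (\<i> * cis c) z = norm z * sin (Arg z - c)" .
  have Im: "inner \<i> z = Im z" by (simp add: inner_complex_def)
  show ?thesis
  proof (cases "c < Arg z")
    case True
    then have "0 < sin (Arg z - c)" using c Arg_le_pi[of z] by (intro sin_gt_zero) auto
    moreover have "z \<noteq> 0" using True c by (auto simp: Arg_zero)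
    moreover have "0 \<le> Im z" using True c Arg_less_0[of z] by simp
    ultimately show ?thesis using True by (simp add: eq Im)
  next
    case False
    have "sin (Arg z - c) \<le> 0" if "0 \<le> Im z"
      using sin_ge_zero[of "c - Arg z"] False c that Arg_less_0[of z]
      by (simp add: sin_diff algebra_simps)
    then show ?thesis using False by (auto simp: eq Im zero_less_mult_iff)
  qed
qed

lemma convex_Arg_greater:
  assumes "0 < c" "c < pi"
  shows "convex {z. c < Arg z}"
proof -
  have "{z. c < Arg z} = {z. inner \<i> z \<ge> 0} \<inter> {z. inner (\<i> * cis c) z > 0}"
    using Arg_greater_iff_halfplanes[OF assms] by auto
  then show ?thesis
    by (simp only:) (intro convex_Int convex_halfspace_ge convex_halfspace_gt)
qed

lemma frontier_Arg_greater:
  assumes c: "0 < c" "c < pi"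
  shows "frontier {z. c < Arg z} = complex_of_real ` {..0} \<union> ray (cis c)"
proof -
  let ?b = "\<i> * cis c"
  let ?S = "{z. inner \<i> z \<ge> 0}" and ?T = "{z. inner ?b z > 0}"
  have sin_c: "0 < sin c" using c by (intro sin_gt_zero)
  have eq: "{z. c < Arg z} = ?S \<inter> ?T" using Arg_greater_iff_halfplanes[OF c] by auto
  have int_S: "interior ?S = {z. inner \<i> z > 0}" by (rule interior_halfspace_ge) simp
  have open_T: "open ?T" by (rule open_halfspace_gt)
  have b: "?b \<noteq> 0" by simp
  \<comment> \<open>The bisector of the cone is an interior point of both half-planes.\<close>
  have "cis ((c + pi) / 2) \<in> {z. inner \<i> z > 0} \<inter> ?T"
  proof -
    have "0 < sin ((c + pi) / 2)" using c by (intro sin_gt_zero) auto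
    moreover have "0 < sin ((c + pi) / 2 - c)" using c by (intro sin_gt_zero) (auto simp: field_simps)
    moreover have "inner ?b (cis ((c + pi) / 2)) = sin ((c + pi) / 2 - c)"
      by (simp only: inner_complex_def sin_diff) simp
    ultimately have "0 < inner ?b (cis ((c + pi) / 2))" "0 < inner \<i> (cis ((c + pi) / 2))"
      by (simp_all only: inner_complex_def) simp_all
    then show ?thesis by blast
  qed
  then have "cis ((c + pi) / 2) \<in> rel_interior ?S \<inter> rel_interior ?T"
    using interior_subset_rel_interior[of ?S] rel_interior_open[OF open_T] int_S by auto
  then have "rel_interior ?S \<inter> rel_interior ?T \<noteq> {}" by (metis empty_iff)
  then have "closure (?S \<inter> ?T) = closure ?S \<inter> closure ?T"
    by (intro closure_Int_convex convex_halfspace_ge convex_halfspace_gt)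
  also have "\<dots> = ?S \<inter> {z. inner ?b z \<ge> 0}"
    by (simp only: closure_halfspace_gt[OF b] closure_closed[OF closed_halfspace_ge])
  finally have clo: "closure (?S \<inter> ?T) = ?S \<inter> {z. inner ?b z \<ge> 0}" .
  have int: "interior (?S \<inter> ?T) = {z. inner \<i> z > 0} \<inter> ?T"
    by (simp only: interior_Int int_S interior_open[OF open_T])
  have inner_b: "inner ?b z = Im z * cos c - Re z * sin c" for z
    by (simp add: inner_complex_def)
  have "frontier {z. c < Arg z} =
      {z. 0 \<le> Im z \<and> 0 \<le> inner ?b z \<and> (Im z = 0 \<or> inner ?b z = 0)}"
    unfolding frontier_def eq clo int by (auto simp: inner_complex_def)
  also have "\<dots> = complex_of_real ` {..0} \<union> ray (cis c)" (is "?A = ?B")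
  proof (intro equalityI subsetI)
    fix z assume z: "z \<in> ?A"
    show "z \<in> ?B"
    proof (cases "Im z = 0")
      case True
      with z sin_c have "Re z \<le> 0" by (auto simp: inner_b mult_le_0_iff)
      with True show ?thesis by (intro UnI1 image_eqI[where x = "Re z"]) (auto simp: complex_eq_iff)
    next
      case False
      with z have "Im z * cos c = Re z * sin c" "0 \<le> Im z" by (auto simp: inner_b)
      then have "z = (Im z / sin c) *\<^sub>R cis c" "0 \<le> Im z / sin c"
        using sin_c by (auto simp: complex_eq_iff field_simps)
      then show ?thesis unfolding ray_def by blast
    qed
  next
    fix z assume "z \<in> ?B"
    then show "z \<in> ?A"
      using sin_c by (auto simp: ray_def inner_b mult_nonpos_nonneg algebra_simps)
  qed
  finally show ?thesis .
qed

lemma Arg_le_on_ray_cis: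
  assumes "0 < c" "c < pi" "z \<in> ray (cis c)"
  shows "Arg z \<le> c"
proof -
  from assms(3) obtain t where t: "0 \<le> t" "z = t *\<^sub>R cis c" by (auto simp: ray_def)
  show ?thesis
  proof (cases "t = 0")
    case False
    with t have "Arg z = Arg (cis c)" by (simp add: scaleR_conv_of_real)
    with assms show ?thesis by (simp add: Arg_cis)
  qed (use t assms in \<open>simp add: Arg_zero\<close>)
qed

section \<open>The root set as a half-open convex cone\<close>

theorem theorem1p3:
  assumes "CARD('n::finite) \<ge> 2"
  shows
    "(convex (dual_steiner_roots TYPE('n)) \<and>
      (\<forall>z \<in> dual_steiner_roots TYPE('n). \<forall>t::real. t > 0 \<longrightarrow> t *\<^sub>R z \<in> dual_steiner_roots TYPE('n)) \<and>
      complex_of_real ` {..<0} \<subseteq> dual_steiner_roots TYPE('n)) \<and>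
     (\<exists>w. w \<noteq> 0 \<and> ray w \<noteq> complex_of_real ` {..0} \<and>
        frontier (dual_steiner_roots TYPE('n)) = complex_of_real ` {..0} \<union> ray w \<and>
        ray w \<inter> dual_steiner_roots TYPE('n) = {}) \<and>
     (CARD('m::finite) = CARD('n) + 1 \<longrightarrow>
        dual_steiner_roots TYPE('n) \<subseteq> dual_steiner_roots TYPE('m))"
proof -
  define c where "c = pi / real CARD('n)"
  have c: "0 < c" "c < pi" using assms by (auto simp: c_def field_simps)
  have roots: "dual_steiner_roots TYPE('n) = {z. c < Arg z}"
    using dual_steiner_roots_eq[OF assms] by (simp add: c_def)
  have "cis c \<in> ray (cis c)" by (auto simp: ray_def intro!: exI[where x = 1])
  moreover have "cis c \<notin> complex_of_real ` {..0}"
    using sin_gt_zero[OF c] by (auto simp: complex_eq_iff)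
  ultimately have "ray (cis c) \<noteq> complex_of_real ` {..0}" by blast
  moreover have "ray (cis c) \<inter> {z. c < Arg z} = {}"
    using Arg_le_on_ray_cis[OF c] by force
  ultimately have half_open: "\<exists>w. w \<noteq> 0 \<and> ray w \<noteq> complex_of_real ` {..0} \<and>
      frontier {z. c < Arg z} = complex_of_real ` {..0} \<union> ray w \<and> ray w \<inter> {z. c < Arg z} = {}"
    using frontier_Arg_greater[OF c] by (intro exI[where x = "cis c"]) auto
  have mono: "{z. c < Arg z} \<subseteq> dual_steiner_roots TYPE('m)" if m: "CARD('m) = CARD('n) + 1"
  proof -
    have "pi / real CARD('m) \<le> c"
      unfolding c_def m by (intro divide_left_mono) auto
    moreover have "2 \<le> CARD('m)" using assms m by simp
    ultimately show ?thesis by (auto simp: dual_steiner_roots_eq)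
  qed
  show ?thesis
    unfolding roots using convex_Arg_greater[OF c] c half_open mono
    by (auto simp: scaleR_conv_of_real)
qed

end
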